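(* Let $L>2$ and $B\in[1,\infty]$. For all probability measures $\mathbb P$ and $\mathbb Q$ on $\mathcal X=(0,1)^d$ we have $$\min\big(c_1\,\mathsf W_1(\mathbb P,\mathbb Q),\;c_2\,\mathsf W_1(\mathbb P,\mathbb Q)^2\big)\;\le\;\mathsf V_{\mathrm{Lip}(L,B)}(\mathbb P,\mathbb Q)\;\le\;L\,\mathsf W_1(\mathbb P,\mathbb Q),$$ where $c_1=\frac12\,\frac{\log(2-2/L)}{d^{1/p}}$ and $c_2=\frac{1}{2d^{2/p}}\,\frac{1}{L(L-1)}$, with the convention $1/p=0$ if $p=\infty$.
   Context: Fix $d\in\mathbb N$ and $p\in[1,\infty]$; $\mathbb R^d$ carries the $\ell_p$-norm $|\cdot|_p$, and $\mathcal X=(0,1)^d$. For $L>0$, $B\in(0,\infty]$, $\mathrm{Lip}(L,B)$ is the set of functions $f:\mathcal X\to\mathbb R$ with $\|f\|_\infty\le B$ and $|f(x)-f(y)|\le L|x-y|_p$ for all $x,y\in\mathcal X$; $\mathrm{Lip}(L)=\mathrm{Lip}(L,\infty)$. For a set $\mathcal W$ of measurable functions $W:\mathcal X\to\mathbb R$ the Vanilla GAN distance is $$\mathsf V_{\mathcal W}(\mathbb P,\mathbb Q)=\sup_{W\in\mathcal W}\mathbb E_{X\sim\mathbb P,\,Y\sim\mathbb Q}\Big[-\log\Big(\frac{1+e^{-W(X)}}2\Big)-\log\Big(\frac{1+e^{W(Y)}}2\Big)\Big].$$ The Wasserstein-1 distance is $\mathsf W_1(\mathbb P,\mathbb Q)=\sup_{W\in\mathrm{Lip}(1)}\mathbb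 E_{X\sim\mathbb P,\,Y\sim\mathbb Q}[W(X)-W(Y)]$. *)

theory Defs
  imports "HOL-Probability.Probability"
begin

text \<open>The value of \<open>1/p\<close> for \<open>p \<in> [1,\<infinity>]\<close>, with the convention \<open>1/\<infinity> = 0\<close>.\<close>

definition recip :: "ereal \<Rightarrow> real" where
  "recip p = (if p = \<infinity> then 0 else 1 / real_of_ereal p)"

definition lp_norm :: "ereal \<Rightarrow> real ^ 'n \<Rightarrow> real" where
  "lp_norm p x =
     (if p = \<infinity> then Max (range (\<lambda>i. \<bar>x $ i\<bar>))
      else (\<Sum>i\<in>UNIV. \<bar>x $ i\<bar> powr real_of_ereal p) powr recip p)"

definition unit_cube :: "(real ^ 'n) set" where
  "unit_cube = {x. \<forall>i. 0 < x $ i \<and> x $ i < 1}"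

text \<open>Functions \<open>\<X> \<rightarrow> \<real>\<close> are represented by total functions whose values outside
  the cube are irrelevant.\<close>

definition Lip :: "ereal \<Rightarrow> real \<Rightarrow> ereal \<Rightarrow> (real ^ 'n \<Rightarrow> real) set" where
  "Lip p L B = {f. (SUP x\<in>unit_cube. ereal \<bar>f x\<bar>) \<le> B \<and>
     (\<forall>x\<in>unit_cube. \<forall>y\<in>unit_cube. \<bar>f x - f y\<bar> \<le> L * lp_norm p (x - y))}"

definition prob_on_cube :: "(real ^ 'n) measure \<Rightarrow> bool" where
  "prob_on_cube P \<longleftrightarrow> prob_space P \<and> sets P = sets (restrict_space borel unit_cube)"

text \<open>Both distances are suprema in the extended reals, over Bochner integrals with respect to
  the product measure. Lipschitz functions are bounded on the cube, so for them all integrands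
  below are integrable, and the value \<open>0\<close> which the Bochner integral assigns to non-integrable
  functions is never used.\<close>

definition vanilla_gan ::
  "(real ^ 'n \<Rightarrow> real) set \<Rightarrow> (real ^ 'n) measure \<Rightarrow> (real ^ 'n) measure \<Rightarrow> ereal" where
  "vanilla_gan \<W> P Q = (SUP W\<in>\<W>. ereal (\<integral>(x, y).
     (- ln ((1 + exp (- W x)) / 2) - ln ((1 + exp (W y)) / 2)) \<partial>(P \<Otimes>\<^sub>M Q)))"

definition wasserstein1 ::
  "ereal \<Rightarrow> (real ^ 'n) measure \<Rightarrow> (real ^ 'n) measure \<Rightarrow> ereal" where
  "wasserstein1 p P Q = (SUP W\<in>Lip p 1 \<infinity>. ereal (\<integral>(x, y). (W x - W y) \<partial>(P \<Otimes>\<^sub>M Q)))"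

end

theory Submission imports Defs begin

text \<open>The GAN loss \<open>\<phi> w = - ln ((1 + exp (- w)) / 2)\<close> satisfies
  \<open>w / 2 - w\<^sup>2 / 8 \<le> \<phi> w \<le> w / 2\<close>. By the right inequality the GAN
  objective of an \<open>L\<close>-Lipschitz \<open>W\<close> is at most \<open>L\<close> times the Wasserstein objective of the
  1-Lipschitz function \<open>W / (2 L)\<close>. For the lower bound let \<open>D = d powr (1/p)\<close>
  be the diameter of the cube, let \<open>W\<close> be 1-Lipschitz with \<open>W c = 0\<close> at the centre \<open>c\<close>, so that
  \<open>\<bar>W\<bar> \<le> D / 2\<close>, and let \<open>\<Delta>\<close> be the difference of its expectations. Then \<open>(2 \<Delta> / D\<^sup>2) W\<close> is
  an admissible discriminator, and the left inequality shows that it attains at least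
  \<open>3/4 \<Delta>\<^sup>2 / D\<^sup>2\<close>. Since \<open>L (L - 1) > 2\<close>, the quadratic term alone is
  therefore always a lower bound.\<close>

section \<open>The loss function\<close>

text \<open>The AM-GM inequality for \<open>1\<close> and \<open>exp (- w)\<close>: their mean is at
  least \<open>exp (- w / 2)\<close>.\<close>

lemma gan_loss_le: "- ln ((1 + exp (- w)) / 2) \<le> w / 2" for w :: real
proof -
  have "0 \<le> (1 - exp (- w / 2))\<^sup>2" by simp
  also have "\<dots> = 1 + exp (- w) - 2 * exp (- w / 2)"
    by (simp add: power2_eq_square algebra_simps flip: exp_add)
  finally have "ln (exp (- w / 2)) \<le> ln ((1 + exp (- w)) / 2)"
    by (subst ln_le_cancel_iff) (auto intro: add_pos_pos)
  then show ?thesis by simp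
qed

text \<open>Hoeffding's lemma for a fair Bernoulli variable, whose moment generating function at
  \<open>h\<close> is \<open>(1 + exp h) / 2\<close>.\<close>

lemma gan_loss_ge: "w / 2 - w\<^sup>2 / 8 \<le> - ln ((1 + exp (- w)) / 2)" for w :: real
proof -
  have aux: "ln ((1 + exp h) / 2) \<le> h / 2 + h\<^sup>2 / 8" if "h \<ge> 0" for h :: real
  proof -
    have eq: "1 + 1 / 2 * (exp h - 1) = (1 + exp h) / 2" by (simp add: field_simps)
    have "- h * (1 / 2) + ln (1 + 1 / 2 * (exp h - 1)) \<le> h\<^sup>2 / 8"
      by (rule Hoeffdings_lemma_aux[OF that]) simp
    then show ?thesis unfolding eq by linarith
  qed
  show ?thesis
  proof (cases "w \<le> 0")
    case True
    then show ?thesis using aux[of "- w"] by simp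
  next
    case False
    have pos: "0 < (1 + exp w) / 2" by (simp add: add_pos_pos)
    \<comment> \<open>The Hoeffding estimate \<open>aux\<close> needs a nonnegative exponent.
      Splitting off \<open>exp (- w)\<close> makes it usable at \<open>w\<close>, and the linear
      terms combine to \<open>w - w / 2 = w / 2\<close>.\<close>
    have "(1 + exp (- w)) / 2 = exp (- w) * ((1 + exp w) / 2)"
      by (simp add: algebra_simps flip: exp_add)
    then have "ln ((1 + exp (- w)) / 2) = - w + ln ((1 + exp w) / 2)"
      using ln_mult_pos[OF exp_gt_zero[of "- w"] pos] by (simp only: ln_exp)
    then show ?thesis using aux[of w] False by simp
  qed
qed

section \<open>Lipschitz functions on the cube\<close>

lemma lp_norm_nonneg: "0 \<le> lp_norm p (x :: real ^ 'n)"
proof (cases "p = \<infinity>")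
  case True
  have "\<bar>x $ undefined\<bar> \<le> Max (range (\<lambda>i. \<bar>x $ i\<bar>))" by (rule Max_ge) auto
  then have "0 \<le> Max (range (\<lambda>i. \<bar>x $ i\<bar>))" by (rule order_trans[OF abs_ge_zero])
  then show ?thesis using True by (simp add: lp_norm_def)
qed (simp add: lp_norm_def)

text \<open>Comparison with the maximum norm. It serves twice: for the distance to the centre of the
  cube, and for passing to the Euclidean norm in the proof of measurability.\<close>

lemma lp_norm_le:
  fixes x :: "real ^ 'n"
  assumes "1 \<le> p" and r: "\<And>i. \<bar>x $ i\<bar> \<le> r"
  shows "lp_norm p x \<le> real CARD('n) powr recip p * r"
proof (cases "p = \<infinity>")
  case True
  then show ?thesis using r by (simp add: lp_norm_def recip_def)
next
  case False
  with \<open>1 \<le> p\<close> obtain q where q: "p = ereal q" "1 \<le> q" by (cases p) auto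
  have r0: "0 \<le> r" using r[of undefined] by linarith
  have "(\<Sum>i\<in>UNIV. \<bar>x $ i\<bar> powr q) \<le> (\<Sum>i\<in>(UNIV :: 'n set). r powr q)"
    using q by (intro sum_mono powr_mono2 r) auto
  then have "(\<Sum>i\<in>UNIV. \<bar>x $ i\<bar> powr q) powr (1 / q) \<le> (real CARD('n) * r powr q) powr (1 / q)"
    using q by (intro powr_mono2 sum_nonneg) auto
  also have "\<dots> = real CARD('n) powr (1 / q) * r"
    using q r0 by (simp add: powr_mult powr_powr)
  finally show ?thesis using q by (simp add: lp_norm_def recip_def)
qed

lemma Lip_center_bound:
  fixes W :: "real ^ 'n \<Rightarrow> real"
  assumes "1 \<le> p" "0 \<le> L" "W \<in> Lip p L B" "x \<in> unit_cube"
  shows "\<bar>W x - W (\<chi> i. 1 / 2)\<bar> \<le> L * (real CARD('n) powr recip p / 2)"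
proof -
  have c: "(\<chi> i. 1 / 2) \<in> (unit_cube :: (real ^ 'n) set)" by (simp add: unit_cube_def)
  have "lp_norm p (x - (\<chi> i. 1 / 2)) \<le> real CARD('n) powr recip p * (1 / 2)"
  proof (rule lp_norm_le[OF \<open>1 \<le> p\<close>])
    fix i
    have "0 < x $ i" "x $ i < 1" using \<open>x \<in> unit_cube\<close> by (auto simp: unit_cube_def)
    then show "\<bar>(x - (\<chi> i. 1 / 2)) $ i\<bar> \<le> 1 / 2" by (simp add: abs_if)
  qed
  then have "L * lp_norm p (x - (\<chi> i. 1 / 2)) \<le> L * (real CARD('n) powr recip p / 2)"
    using \<open>0 \<le> L\<close> by (intro mult_left_mono) auto
  moreover have "\<bar>W x - W (\<chi> i. 1 / 2)\<bar> \<le> L * lp_norm p (x - (\<chi> i. 1 / 2))"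
    using assms c by (simp add: Lip_def)
  ultimately show ?thesis by linarith
qed

text \<open>Each coordinate is bounded by the Euclidean norm, so \<open>W\<close> is Lipschitz for
  it on the cube. Continuity there is enough, because \<open>P\<close> carries the trace of the
  Borel sets on the cube.\<close>

lemma Lip_measurable:
  fixes W :: "real ^ 'n \<Rightarrow> real"
  assumes "1 \<le> p" "0 \<le> L" "W \<in> Lip p L B" "prob_on_cube P"
  shows "W \<in> borel_measurable P"
proof -
  let ?D = "real CARD('n) powr recip p"
  have "(L * ?D)-lipschitz_on unit_cube W"
  proof (rule lipschitz_onI)
    fix x y :: "real ^ 'n" assume xy: "x \<in> unit_cube" "y \<in> unit_cube"
    have "lp_norm p (x - y) \<le> ?D * norm (x - y)"
      by (rule lp_norm_le[OF \<open>1 \<le> p\<close>]) (rule component_le_norm_cart)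
    then have "L * lp_norm p (x - y) \<le> L * ?D * norm (x - y)"
      using \<open>0 \<le> L\<close> by (simp add: mult_left_mono mult.assoc)
    moreover have "\<bar>W x - W y\<bar> \<le> L * lp_norm p (x - y)" using assms xy by (simp add: Lip_def)
    ultimately show "dist (W x) (W y) \<le> L * ?D * dist x y" by (simp add: dist_real_def dist_norm)
  qed (use \<open>0 \<le> L\<close> in simp)
  then have "W \<in> borel_measurable (restrict_space borel unit_cube)"
    by (intro borel_measurable_continuous_on_restrict lipschitz_on_continuous_on)
  moreover have "sets P = sets (restrict_space borel unit_cube)"
    using \<open>prob_on_cube P\<close> by (simp add: prob_on_cube_def)
  ultimately show ?thesis using measurable_cong_sets by blast
qed

lemma Lip_cmult:
  assumes "W \<in> Lip p L B" "\<bar>t\<bar> * L \<le> L'"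
    and "\<And>x. x \<in> unit_cube \<Longrightarrow> ereal \<bar>t * (W x - c)\<bar> \<le> B'"
  shows "(\<lambda>x. t * (W x - c)) \<in> Lip p L' B'"
proof -
  have "\<bar>t * (W x - c) - t * (W y - c)\<bar> \<le> L' * lp_norm p (x - y)"
    if "x \<in> unit_cube" "y \<in> unit_cube" for x y
  proof -
    have "\<bar>t * (W x - c) - t * (W y - c)\<bar> = \<bar>t\<bar> * \<bar>W x - W y\<bar>"
      by (simp add: algebra_simps flip: abs_mult)
    also have "\<dots> \<le> \<bar>t\<bar> * (L * lp_norm p (x - y))"
      using assms(1) that by (intro mult_left_mono) (auto simp: Lip_def)
    also have "\<dots> \<le> L' * lp_norm p (x - y)"
      using mult_right_mono[OF assms(2) lp_norm_nonneg[of p "x - y"]] by (simp add: mult.assoc)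
    finally show ?thesis .
  qed
  then show ?thesis using assms(3) by (auto simp: Lip_def intro: SUP_least)
qed

lemma zero_in_Lip: "0 \<le> L \<Longrightarrow> 0 \<le> B \<Longrightarrow> (\<lambda>x. 0) \<in> Lip p L B"
proof -
  assume "0 \<le> L" "0 \<le> B"
  from \<open>0 \<le> B\<close> have "ereal \<bar>0\<bar> \<le> B" by (simp only: abs_zero zero_ereal_def)
  then have "(SUP x\<in>unit_cube. ereal \<bar>0\<bar>) \<le> B" by (intro SUP_least)
  then show ?thesis using \<open>0 \<le> L\<close> by (simp add: Lip_def lp_norm_nonneg)
qed

section \<open>Expectations over the product measure\<close>

context
  fixes p :: ereal and P Q :: "(real ^ 'n) measure"
  assumes p: "1 \<le> p" and P: "prob_on_cube P" and Q: "prob_on_cube Q"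
begin

lemma pair_prob: "pair_prob_space P Q"
proof -
  interpret P: prob_space P using P by (simp add: prob_on_cube_def)
  interpret Q: prob_space Q using Q by (simp add: prob_on_cube_def)
  show ?thesis by unfold_locales
qed

text \<open>From here on, facts with the prefix \<open>P.\<close> concern the product measure and
  not the first factor.\<close>

interpretation pair_prob_space P Q by (rule pair_prob)

lemma space_pair: "space (P \<Otimes>\<^sub>M Q) = unit_cube \<times> unit_cube"
proof -
  have "space P = unit_cube" "space Q = unit_cube"
    using P Q sets_eq_imp_space_eq[of _ "restrict_space borel unit_cube"]
    by (auto simp: prob_on_cube_def space_restrict_space)
  then show ?thesis by (simp add: space_pair_measure)
qed

lemma integrable_Lip_diff:
  assumes "0 \<le> L" "W \<in> Lip p L B"
  shows "integrable (P \<Otimes>\<^sub>M Q) (\<lambda>(x, y). W x - W y)"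
proof (rule P.integrable_const_bound)
  show "AE z in P \<Otimes>\<^sub>M Q. norm ((\<lambda>(x, y). W x - W y) z) \<le> L * real CARD('n) powr recip p"
  proof (rule AE_I2)
    fix z assume "z \<in> space (P \<Otimes>\<^sub>M Q)"
    then obtain x y where "z = (x, y)" "x \<in> unit_cube" "y \<in> unit_cube"
      by (auto simp: space_pair)
    then show "norm ((\<lambda>(x, y). W x - W y) z) \<le> L * real CARD('n) powr recip p"
      using Lip_center_bound[OF p assms, of x] Lip_center_bound[OF p assms, of y]
      unfolding \<open>z = (x, y)\<close> real_norm_def prod.case by linarith
  qed
  note [measurable] = Lip_measurable[OF p assms P] Lip_measurable[OF p assms Q]
  show "(\<lambda>(x, y). W x - W y) \<in> borel_measurable (P \<Otimes>\<^sub>M Q)"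
    by measurable
qed

text \<open>Both summands are values of the loss, at \<open>W x\<close> and at \<open>- W y\<close>.
  Since \<open>W\<close> is bounded on the cube, the two quadratic estimates confine them to a
  bounded interval.\<close>

lemma integrable_gan_loss:
  assumes "0 \<le> L" "W \<in> Lip p L B"
  shows "integrable (P \<Otimes>\<^sub>M Q)
    (\<lambda>(x, y). - ln ((1 + exp (- W x)) / 2) - ln ((1 + exp (W y)) / 2))" (is "integrable _ ?F")
proof (rule P.integrable_const_bound)
  define M where "M = \<bar>W (\<chi> i. 1 / 2)\<bar> + L * (real CARD('n) powr recip p / 2)"
  have M: "\<bar>W x\<bar> \<le> M" if "x \<in> unit_cube" for x
    using Lip_center_bound[OF p assms that] unfolding M_def by linarith
  have loss: "\<bar>ln ((1 + exp (- w)) / 2)\<bar> \<le> M / 2 + M\<^sup>2 / 8" if "\<bar>w\<bar> \<le> M" for w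
    using gan_loss_le[of w] gan_loss_ge[of w] power_mono[OF that, of 2] that
    by (simp only: abs_le_iff power2_abs) linarith
  show "AE z in P \<Otimes>\<^sub>M Q. norm (?F z) \<le> 2 * (M / 2 + M\<^sup>2 / 8)"
  proof (rule AE_I2)
    fix z assume "z \<in> space (P \<Otimes>\<^sub>M Q)"
    then obtain x y where z: "z = (x, y)" "x \<in> unit_cube" "y \<in> unit_cube"
      by (auto simp: space_pair)
    show "norm (?F z) \<le> 2 * (M / 2 + M\<^sup>2 / 8)"
      using loss[of "W x"] loss[of "- W y"] M[of x] M[of y] z by simp
  qed
  note [measurable] = Lip_measurable[OF p assms P] Lip_measurable[OF p assms Q]
  show "?F \<in> borel_measurable (P \<Otimes>\<^sub>M Q)" by measurable
qed

lemma gan_loss_integral_le: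
  assumes "0 < L" "W \<in> Lip p L B"
  shows "ereal (\<integral>(x, y). (- ln ((1 + exp (- W x)) / 2) - ln ((1 + exp (W y)) / 2)) \<partial>(P \<Otimes>\<^sub>M Q))
    \<le> ereal L * wasserstein1 p P Q"
proof -
  let ?E = "\<lambda>V. \<integral>(x, y). (V x - V y) \<partial>(P \<Otimes>\<^sub>M Q)"
  \<comment> \<open>The factor makes \<open>L * V\<close> equal to \<open>W / 2\<close>, the linear
    upper bound of the loss; the Lipschitz constant of \<open>V\<close> is then at most 1/2.\<close>
  define V where "V = (\<lambda>x. 1 / (2 * L) * (W x - 0))"
  have "V \<in> Lip p 1 \<infinity>"
    unfolding V_def by (rule Lip_cmult[OF assms(2)]) (use \<open>0 < L\<close> in auto)
  then have V: "ereal (?E V) \<le> wasserstein1 p P Q"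
    unfolding wasserstein1_def by (rule SUP_upper)
  have iW: "integrable (P \<Otimes>\<^sub>M Q) (\<lambda>(x, y). W x - W y)"
    using assms by (intro integrable_Lip_diff) auto
  have VW: "(\<lambda>(x, y). V x - V y) = (\<lambda>z. 1 / (2 * L) * (case z of (x, y) \<Rightarrow> W x - W y))"
    by (auto simp: V_def diff_divide_distrib)
  have "(\<integral>(x, y). (- ln ((1 + exp (- W x)) / 2) - ln ((1 + exp (W y)) / 2)) \<partial>(P \<Otimes>\<^sub>M Q))
      \<le> (\<integral>z. 1 / 2 * (case z of (x, y) \<Rightarrow> W x - W y) \<partial>(P \<Otimes>\<^sub>M Q))"
  proof (rule integral_mono)
    fix z :: "(real ^ 'n) \<times> (real ^ 'n)"
    show "(case z of (x, y) \<Rightarrow> - ln ((1 + exp (- W x)) / 2) - ln ((1 + exp (W y)) / 2))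
        \<le> 1 / 2 * (case z of (x, y) \<Rightarrow> W x - W y)"
      using gan_loss_le[of "W (fst z)"] gan_loss_le[of "- W (snd z)"]
      by (simp add: case_prod_beta field_simps)
  qed (use assms iW integrable_gan_loss[of L W B] in auto)
  also have "\<dots> = L * ?E V" using \<open>0 < L\<close> unfolding VW by simp
  finally have "ereal (\<integral>(x, y). (- ln ((1 + exp (- W x)) / 2) - ln ((1 + exp (W y)) / 2)) \<partial>(P \<Otimes>\<^sub>M Q))
      \<le> ereal L * ereal (?E V)" by simp
  also have "\<dots> \<le> ereal L * wasserstein1 p P Q"
    using V \<open>0 < L\<close> by (intro ereal_mult_left_mono) auto
  finally show ?thesis .
qed

lemma vanilla_gan_ge_square:
  assumes "2 \<le> L" "1 \<le> B" and W: "W \<in> Lip p 1 \<infinity>"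
  shows "ereal (3 / 4 * ((\<integral>(x, y). (W x - W y) \<partial>(P \<Otimes>\<^sub>M Q)) / real CARD('n) powr recip p)\<^sup>2)
    \<le> vanilla_gan (Lip p L B) P Q"
proof -
  define D where "D = real CARD('n) powr recip p"
  define \<Delta> where "\<Delta> = (\<integral>(x, y). (W x - W y) \<partial>(P \<Otimes>\<^sub>M Q))"
  \<comment> \<open>The lower bound \<open>t * \<Delta> / 2 - (t * D)\<^sup>2 / 16\<close> below
    would be largest at \<open>4 * \<Delta> / D\<^sup>2\<close>. Half of this still yields 3/4 of
    the maximum, and as \<open>\<bar>\<Delta>\<bar> \<le> D\<close> it keeps
    \<open>\<bar>f\<bar> \<le> 1 \<le> B\<close> and
    \<open>\<bar>t\<bar> \<le> 2 \<le> L\<close>.\<close>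
  define t where "t = 2 * \<Delta> / D\<^sup>2"
  define c where "c = W (\<chi> i. 1 / 2)"
  define f where "f = (\<lambda>x. t * (W x - c))"
  have "0 \<le> recip p" using p by (cases p) (auto simp: recip_def)
  then have D: "1 \<le> D" unfolding D_def by (intro ge_one_powr_ge_zero) (auto simp: Suc_leI)
  have WD: "\<bar>W x - c\<bar> \<le> D / 2" if "x \<in> unit_cube" for x
    using Lip_center_bound[OF p _ W that] by (simp add: D_def c_def)
  have iW: "integrable (P \<Otimes>\<^sub>M Q) (\<lambda>(x, y). W x - W y)"
    by (rule integrable_Lip_diff[OF _ W]) simp
  have "\<bar>\<Delta>\<bar> \<le> D"
  proof -
    have "\<bar>\<Delta>\<bar> \<le> (\<integral>z. \<bar>case z of (x, y) \<Rightarrow> W x - W y\<bar> \<partial>(P \<Otimes>\<^sub>M Q))"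
      unfolding \<Delta>_def by (rule integral_abs_bound)
    also have "\<dots> \<le> (\<integral>z. D \<partial>(P \<Otimes>\<^sub>M Q))"
    proof (rule integral_mono)
      fix z assume "z \<in> space (P \<Otimes>\<^sub>M Q)"
      then obtain x y where "z = (x, y)" "x \<in> unit_cube" "y \<in> unit_cube"
        by (auto simp: space_pair)
      then show "\<bar>case z of (x, y) \<Rightarrow> W x - W y\<bar> \<le> D"
        using WD[of x] WD[of y] unfolding \<open>z = (x, y)\<close> prod.case by linarith
    qed (use iW in auto)
    finally show ?thesis by (simp add: P.prob_space)
  qed
  then have tD: "\<bar>t\<bar> * D \<le> 2"
    using D by (simp add: t_def abs_mult power2_eq_square field_simps)
  \<comment> \<open>Here \<open>1 \<le> D\<close> turns the bound on the range of \<open>f\<close>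
    into one on its Lipschitz constant.\<close>
  have t2: "\<bar>t\<bar> \<le> 2" using tD D mult_left_mono[OF D, of "\<bar>t\<bar>"] by simp
  have f1: "\<bar>f x\<bar> \<le> \<bar>t\<bar> * D / 2" if "x \<in> unit_cube" for x
    using mult_left_mono[OF WD[OF that], of "\<bar>t\<bar>"] by (simp add: f_def abs_mult)
  have f: "f \<in> Lip p L B"
    unfolding f_def
  proof (rule Lip_cmult[OF W])
    fix x :: "real ^ 'n" assume "x \<in> unit_cube"
    then have "ereal \<bar>t * (W x - c)\<bar> \<le> 1" using f1[of x] tD by (simp add: f_def)
    then show "ereal \<bar>t * (W x - c)\<bar> \<le> B" using \<open>1 \<le> B\<close> by (rule order_trans)
  qed (use t2 \<open>2 \<le> L\<close> in simp)
  \<comment> \<open>The constant collects the error terms \<open>(f x)\<^sup>2 / 8\<close> and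
    \<open>(f y)\<^sup>2 / 8\<close>, each at most \<open>(t * D)\<^sup>2 / 32\<close>. The shift by
    \<open>c\<close> cancels in the difference of expectations.\<close>
  have "t * \<Delta> / 2 - (t * D)\<^sup>2 / 16
      = (\<integral>z. t / 2 * (case z of (x, y) \<Rightarrow> W x - W y) - (t * D)\<^sup>2 / 16 \<partial>(P \<Otimes>\<^sub>M Q))"
    using iW by (subst Bochner_Integration.integral_diff) (auto simp: P.prob_space \<Delta>_def)
  also have "\<dots> \<le> (\<integral>(x, y). (- ln ((1 + exp (- f x)) / 2) - ln ((1 + exp (f y)) / 2)) \<partial>(P \<Otimes>\<^sub>M Q))"
  proof (rule integral_mono)
    fix z assume "z \<in> space (P \<Otimes>\<^sub>M Q)"
    then obtain x y where z: "z = (x, y)" "x \<in> unit_cube" "y \<in> unit_cube"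
      by (auto simp: space_pair)
    have sq: "(f x)\<^sup>2 \<le> (t * D)\<^sup>2 / 4" if "x \<in> unit_cube" for x
      using power_mono[OF f1[OF that], of 2] by (simp add: power_divide power_mult_distrib)
    have eq: "t / 2 * (W x - W y) = f x / 2 - f y / 2" by (simp add: f_def right_diff_distrib diff_divide_distrib)
    show "t / 2 * (case z of (x, y) \<Rightarrow> W x - W y) - (t * D)\<^sup>2 / 16
      \<le> (case z of (x, y) \<Rightarrow> - ln ((1 + exp (- f x)) / 2) - ln ((1 + exp (f y)) / 2))"
      using gan_loss_ge[of "f x"] gan_loss_ge[of "- f y"] sq[OF z(2)] sq[OF z(3)]
      unfolding z(1) prod.case eq minus_minus power2_minus by linarith
  qed (use iW integrable_gan_loss[OF _ f] \<open>2 \<le> L\<close> in auto)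
  also have "t * \<Delta> / 2 - (t * D)\<^sup>2 / 16 = 3 / 4 * (\<Delta> / D)\<^sup>2"
    using D by (simp add: t_def power2_eq_square field_simps)
  finally show ?thesis
    unfolding vanilla_gan_def \<Delta>_def[symmetric] D_def[symmetric]
    by (intro SUP_upper2[OF f]) simp
qed

end

theorem theorem3p2:
  fixes p B :: ereal and L :: real and P Q :: "(real ^ 'n) measure"
  assumes "1 \<le> p" and "L > 2" and "1 \<le> B"
    and "prob_on_cube P" and "prob_on_cube Q"
  shows "let d = real CARD('n);
             c1 = (1/2) * (ln (2 - 2 / L) / d powr recip p);
             c2 = (1 / (2 * d powr (2 * recip p))) * (1 / (L * (L - 1)))
         in min (ereal c1 * wasserstein1 p P Q) (ereal c2 * (wasserstein1 p P Q)\<^sup>2)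
              \<le> vanilla_gan (Lip p L B) P Q
          \<and> vanilla_gan (Lip p L B) P Q \<le> ereal L * wasserstein1 p P Q"
proof -
  let ?V = "vanilla_gan (Lip p L B) P Q" and ?W = "wasserstein1 p P Q"
  let ?E = "\<lambda>W. \<integral>(x, y). (W x - W y) \<partial>(P \<Otimes>\<^sub>M Q)"
  define D where "D = real CARD('n) powr recip p"
  define c2 where "c2 = (1 / (2 * real CARD('n) powr (2 * recip p))) * (1 / (L * (L - 1)))"
  have D: "0 < D" by (simp add: D_def)
  have c2_eq: "c2 = 1 / (2 * (L * (L - 1))) / D\<^sup>2"
    by (simp add: c2_def D_def powr_add[symmetric] power2_eq_square)
  have LL: "2 \<le> L * (L - 1)"
    using mult_mono[of 2 L 1 "L - 1"] \<open>L > 2\<close> by simp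
  have c2_pos: "0 < c2" using LL D by (simp add: c2_eq)
  \<comment> \<open>The left side is at most 1/4, so there is room to spare.\<close>
  have "1 / (2 * (L * (L - 1))) \<le> 3 / 4" using LL by (simp add: field_simps)
  then have c2_le: "c2 \<le> 3 / 4 / D\<^sup>2" unfolding c2_eq by (intro divide_right_mono) auto
  have lower: "ereal (c2 * (?E W)\<^sup>2) \<le> ?V" if "W \<in> Lip p 1 \<infinity>" for W
  proof -
    have "c2 * (?E W)\<^sup>2 \<le> 3 / 4 * (?E W / D)\<^sup>2"
      using mult_right_mono[OF c2_le, of "(?E W)\<^sup>2"] by (simp add: power_divide)
    then have "ereal (c2 * (?E W)\<^sup>2) \<le> ereal (3 / 4 * (?E W / D)\<^sup>2)" by simp
    also have "\<dots> \<le> ?V"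
      unfolding D_def using assms that by (intro vanilla_gan_ge_square) auto
    finally show ?thesis .
  qed
  have V0: "0 \<le> ?V"
    using lower[OF zero_in_Lip] by (simp add: case_prod_unfold flip: zero_ereal_def)
  have W0: "0 \<le> ?W"
    unfolding wasserstein1_def by (rule SUP_upper2[OF zero_in_Lip]) (auto simp: case_prod_unfold)
  \<comment> \<open>Instead of moving the square through the supremum, each objective value is
    bounded by a square root, which bounds the supremum and shows that it is finite. An infinite GAN
    distance makes the claim trivial.\<close>
  have square: "ereal c2 * ?W\<^sup>2 \<le> ?V"
  proof (cases ?V)
    case (real v)
    then have v: "0 \<le> v" using V0 by simp
    have "?W \<le> ereal (sqrt (v / c2))"
      unfolding wasserstein1_def
    proof (rule SUP_least)
      fix W :: "real ^ 'n \<Rightarrow> real" assume "W \<in> Lip p 1 \<infinity>"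
      then have "(?E W)\<^sup>2 \<le> v / c2"
        using lower[of W] real c2_pos by (simp add: field_simps)
      then show "ereal (?E W) \<le> ereal (sqrt (v / c2))" by (simp add: real_le_rsqrt)
    qed
    with W0 obtain w where w: "?W = ereal w" "0 \<le> w" "w \<le> sqrt (v / c2)"
      by (cases ?W) auto
    have "w\<^sup>2 \<le> v / c2" using power_mono[OF w(3,2), of 2] v c2_pos by simp
    then show ?thesis using w(1) real c2_pos by (simp add: field_simps)
  qed (use V0 in auto)
  have upper: "?V \<le> ereal L * ?W"
    unfolding vanilla_gan_def
    using assms by (intro SUP_least gan_loss_integral_le) auto
  show ?thesis
    unfolding Let_def c2_def[symmetric] using square upper by (intro conjI min.coboundedI2)
qed

end
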